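(* Let $n$ be a positive integer and $x$ a positive real number with $x\leq n$ and $n-4n/x\geq 30$. Then there exists a Latin trade in $B_n$ which intersects the partial Latin square $Q_{n,\,n-\lceil 4n/x\rceil-30}$ in at most $10\log_4(2x)$ elements.
   Context: $B_n=\{(i,j;i+j \bmod n): i,j\in\mathbb{Z}_n\}$ is the addition table of $\mathbb{Z}_n$, as triples (row, column; symbol). For $i\in\mathbb{Z}_n$ the diagonal $D_i$ is $\{(r,r+i;2r+i \bmod n): r\in\mathbb{Z}_n\}$, and for $0\leq k<n$, $Q_{n,k}:=D_0\cup D_1\cup\dots\cup D_k$. A partial Latin square (PLS) is an array in which some cells may be empty and each symbol occurs at most once per row and column. A Latin trade in $B_n$ is a non-empty PLS $T\subseteq B_n$ for which there is a PLS $T'$ of the same order with $T\cap T'=\emptyset$, the same set of non-empty cells as $T$, and the same set of symbols as $T$ in each row and in each column. *)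

theory Defs
  imports Complex_Main
begin

(* The residues modulo n are represented by 0, ..., n - 1, and an array of order n
   by its set of entries (row, column, symbol). *)

type_synonym entry = "nat \<times> nat \<times> nat"

definition pls :: "nat \<Rightarrow> entry set \<Rightarrow> bool" where
  "pls n P \<longleftrightarrow>
     P \<subseteq> {..<n} \<times> {..<n} \<times> {..<n} \<and>
     (\<forall>r c s s'. (r, c, s) \<in> P \<and> (r, c, s') \<in> P \<longrightarrow> s = s') \<and>
     (\<forall>r c c' s. (r, c, s) \<in> P \<and> (r, c', s) \<in> P \<longrightarrow> c = c') \<and>
     (\<forall>r r' c s. (r, c, s) \<in> P \<and> (r', c, s) \<in> P \<longrightarrow> r = r')"

definition cells :: "entry set \<Rightarrow> (nat \<times> nat) set" where
  "cells P = {(r, c). \<exists>s. (r, c, s) \<in> P}"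

definition row_symbols :: "entry set \<Rightarrow> nat \<Rightarrow> nat set" where
  "row_symbols P r = {s. \<exists>c. (r, c, s) \<in> P}"

definition col_symbols :: "entry set \<Rightarrow> nat \<Rightarrow> nat set" where
  "col_symbols P c = {s. \<exists>r. (r, c, s) \<in> P}"

definition latin_trade_in :: "nat \<Rightarrow> entry set \<Rightarrow> entry set \<Rightarrow> bool" where
  "latin_trade_in n L T \<longleftrightarrow>
     T \<noteq> {} \<and> pls n T \<and> T \<subseteq> L \<and>
     (\<exists>T'. pls n T' \<and> T \<inter> T' = {} \<and> cells T' = cells T \<and>
        (\<forall>r<n. row_symbols T' r = row_symbols T r) \<and>
        (\<forall>c<n. col_symbols T' c = col_symbols T c))"

definition add_table :: "nat \<Rightarrow> entry set" where
  "add_table n = {(i, j, (i + j) mod n) | i j. i < n \<and> j < n}"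

definition diagonal :: "nat \<Rightarrow> nat \<Rightarrow> entry set" where
  "diagonal n i = {(r, (r + i) mod n, (2 * r + i) mod n) | r. r < n}"

definition Q :: "nat \<Rightarrow> nat \<Rightarrow> entry set" where
  "Q n k = (\<Union>i\<le>k. diagonal n i)"

end

theory Submission
  imports Defs "HOL-Number_Theory.Cong"
begin

text \<open>
  A Latin trade in the addition table amounts to a finite set of right isosceles triangles, of either
  orientation, whose three kinds of corners each run once through the same set of points of the
  torus: the right-angle corners are the cells, and a triangle of leg \<open>d\<close> changes the symbol \<open>x + y\<close>
  of its cell to \<open>x + y + d\<close>.  For \<open>n\<close> even four triangles suffice.

  For \<open>n = 2 * m + 1\<close>, a large triangle of side \<open>n\<close> is cut into two triangles and an
  \<open>m\<close> by \<open>m + 1\<close> box.  A nearly square box can be filled by boundedly many triangles except for a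
  box of half the size, which is again nearly square up to a power of two dividing both of its sides;
  this costs about five points per halving.  Once the reduced box is small, it is filled arbitrarily.
  Finally all points are multiplied by the inverse of that power of two modulo \<open>n\<close>: the points of
  the last box are then confined to few consecutive diagonals, and a translation moves these away
  from \<open>Q\<close>, so that \<open>Q\<close> meets only the logarithmically many other points.
\<close>

section \<open>Triangles and tilings of boxes\<close>

definition corner1 :: "int \<times> int \<times> int \<Rightarrow> int \<times> int" where
  "corner1 = (\<lambda>(x, y, d). (x, y))"

definition corner2 :: "int \<times> int \<times> int \<Rightarrow> int \<times> int" where
  "corner2 = (\<lambda>(x, y, d). (x, y + d))"

definition corner3 :: "int \<times> int \<times> int \<Rightarrow> int \<times> int" where
  "corner3 = (\<lambda>(x, y, d). (x + d, y))"

lemmas corner_defs = corner1_def corner2_def corner3_def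

text \<open>
  Every point of \<open>V\<close> is a corner of each of the three kinds; the corners of the box itself are met
  by fewer triangles.  The \<open>d\<close> of a triangle may be negative.
\<close>

definition tiled :: "(int \<times> int \<times> int) set \<Rightarrow> (int \<times> int) set \<Rightarrow> int \<Rightarrow> int \<Rightarrow> bool" where
  "tiled F V a b \<longleftrightarrow> finite F \<and> (\<forall>(x, y, d)\<in>F. d \<noteq> 0) \<and>
     V \<subseteq> {0..a} \<times> {0..b} - {(0, 0), (a, 0), (0, b), (a, b)} \<and>
     bij_betw corner1 F (V \<union> {(0, 0), (a, b)}) \<and>
     bij_betw corner2 F (V \<union> {(a, 0), (0, b)}) \<and>
     bij_betw corner3 F (V \<union> {(a, 0), (0, b)})"

text \<open>
  Ensures that the points on the boundary of a hole differ from the points that the surrounding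
  triangles have on it.
\<close>

definition clear :: "(int \<times> int) set \<Rightarrow> int \<Rightarrow> int \<Rightarrow> bool" where
  "clear V a b \<longleftrightarrow> (\<forall>x. (x, b) \<in> V \<longrightarrow> 3 * x \<le> 2 * a) \<and> (\<forall>y. (a, y) \<in> V \<longrightarrow> 3 * y \<le> 2 * b)"

text \<open>Every filling of the inner box is allowed, so that steps compose. Only the points added
  around it are counted; those of the inner filling are free.\<close>

definition extends :: "nat \<Rightarrow> int \<Rightarrow> int \<Rightarrow> int \<Rightarrow> int \<Rightarrow> bool" where
  "extends k a b X Y \<longleftrightarrow> (\<forall>F V. tiled F V X Y \<and> clear V X Y \<longrightarrow>
     (\<exists>F' W. tiled F' (V \<union> W) a b \<and> clear (V \<union> W) a b \<and> finite W \<and> card W \<le> k))"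

lemma extends_refl: "extends 0 a b a b"
  unfolding extends_def by (metis Un_empty_right card.empty finite.emptyI le_refl)

lemma extends_trans:
  assumes "extends k a b c d" and "extends l c d X Y"
  shows "extends (k + l) a b X Y"
  unfolding extends_def
proof (intro allI impI)
  fix F V assume "tiled F V X Y \<and> clear V X Y"
  then obtain F1 W1 where 1: "tiled F1 (V \<union> W1) c d" "clear (V \<union> W1) c d" "finite W1" "card W1 \<le> l"
    using assms(2) unfolding extends_def by meson
  then obtain F2 W2 where 2: "tiled F2 (V \<union> W1 \<union> W2) a b" "clear (V \<union> W1 \<union> W2) a b" "finite W2" "card W2 \<le> k"
    using assms(1) unfolding extends_def by meson
  have "card (W1 \<union> W2) \<le> k + l"
    using card_Un_le[of W1 W2] 1(4) 2(4) by linarith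
  then show "\<exists>F' W. tiled F' (V \<union> W) a b \<and> clear (V \<union> W) a b \<and> finite W \<and> card W \<le> k + l"
    using 1(3) 2 by (metis Un_assoc finite_Un)
qed

text \<open>Reflection in the diagonal keeps right-angle corners and exchanges the other two kinds,
  in which \<open>tiled\<close> is symmetric.\<close>

lemma tiled_swap:
  assumes "tiled F V a b"
  shows "tiled ((\<lambda>(x, y, d). (y, x, d)) ` F) (prod.swap ` V) b a"
proof -
  let ?s = "\<lambda>(x, y, d). (y, x, d) :: int \<times> int \<times> int"
  have transfer: "bij_betw g (?s ` F) (prod.swap ` B)"
    if "bij_betw f F B" and "\<And>t. g (?s t) = prod.swap (f t)" for f g B
  proof -
    have "bij_betw (prod.swap \<circ> f) F (prod.swap ` B)"
      using that(1) by (intro bij_betw_trans[of f F B]) (auto simp: bij_betw_def)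
    then have "bij_betw (g \<circ> ?s) F (prod.swap ` B)"
      using that(2) by (simp add: o_def)
    moreover have "bij_betw ?s F (?s ` F)"
      by (auto simp: bij_betw_def inj_on_def)
    ultimately show ?thesis
      using bij_betw_comp_iff by blast
  qed
  have "bij_betw corner1 (?s ` F) (prod.swap ` (V \<union> {(0, 0), (a, b)}))"
    using assms unfolding tiled_def by (intro transfer[of corner1]) (auto simp: corner_defs)
  moreover have "bij_betw corner2 (?s ` F) (prod.swap ` (V \<union> {(a, 0), (0, b)}))"
    using assms unfolding tiled_def by (intro transfer[of corner3]) (auto simp: corner_defs)
  moreover have "bij_betw corner3 (?s ` F) (prod.swap ` (V \<union> {(a, 0), (0, b)}))"
    using assms unfolding tiled_def by (intro transfer[of corner2]) (auto simp: corner_defs)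
  ultimately show ?thesis
    using assms unfolding tiled_def by (auto simp: image_Un insert_commute)
qed

lemma clear_swap: "clear V a b \<Longrightarrow> clear (prod.swap ` V) b a"
  unfolding clear_def by auto

text \<open>Lets a halving found for one order of the two sides serve for the other order.\<close>

lemma extends_swap:
  assumes "extends k a b X Y"
  shows "extends k b a Y X"
  unfolding extends_def
proof (intro allI impI)
  fix F V assume "tiled F V Y X \<and> clear V Y X"
  then have "tiled ((\<lambda>(x, y, d). (y, x, d)) ` F) (prod.swap ` V) X Y" "clear (prod.swap ` V) X Y"
    using tiled_swap clear_swap by blast+
  then obtain F' W where F': "tiled F' (prod.swap ` V \<union> W) a b" "clear (prod.swap ` V \<union> W) a b"
      "finite W" "card W \<le> k"
    using assms unfolding extends_def by meson
  have "prod.swap ` (prod.swap ` V \<union> W) = V \<union> prod.swap ` W"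
    by (simp add: image_Un image_comp)
  moreover have "card (prod.swap ` W) \<le> k"
    using F'(3,4) card_image_le le_trans by blast
  ultimately show "\<exists>F' W. tiled F' (V \<union> W) b a \<and> clear (V \<union> W) b a \<and> finite W \<and> card W \<le> k"
    using tiled_swap[OF F'(1)] clear_swap[OF F'(2)] F'(3) by (metis finite_imageI)
qed

section \<open>Filling the region around an inner box\<close>

text \<open>The inner box sits at \<open>(0, 0)\<close>, a corner shared with the outer box. It
  already supplies the right angle at \<open>(X, Y)\<close> and the other two kinds of corner at
  \<open>(X, 0)\<close> and \<open>(0, Y)\<close>; the set \<open>G\<close> supplies exactly what is
  still missing there.\<close>

lemma tiled_Un:
  assumes F: "tiled F V X Y" and "0 < X" "X < a" "0 < Y" "Y < b"
    and G: "finite G" "\<forall>(x, y, d)\<in>G. d \<noteq> 0"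
    and W: "{(X, Y), (X, 0), (0, Y)} \<subseteq> W" "W \<inter> V = {}"
      "W \<subseteq> {0..a} \<times> {0..b} - {(0, 0), (a, 0), (0, b), (a, b)}"
    and "bij_betw corner1 G (W - {(X, Y)} \<union> {(a, b)})"
    and "bij_betw corner2 G (W - {(X, 0), (0, Y)} \<union> {(a, 0), (0, b)})"
    and "bij_betw corner3 G (W - {(X, 0), (0, Y)} \<union> {(a, 0), (0, b)})"
  shows "tiled (F \<union> G) (V \<union> W) a b"
proof -
  have V: "V \<subseteq> {0..X} \<times> {0..Y} - {(0, 0), (X, 0), (0, Y), (X, Y)}"
    and bij: "bij_betw corner1 F (V \<union> {(0, 0), (X, Y)})"
      "bij_betw corner2 F (V \<union> {(X, 0), (0, Y)})" "bij_betw corner3 F (V \<union> {(X, 0), (0, Y)})"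
    using F unfolding tiled_def by auto
  have notin: "(a, b) \<notin> V" "(a, 0) \<notin> V" "(0, b) \<notin> V" "(0, 0) \<notin> W"
    using V W(3) assms(2-5) by auto
  have ne: "X \<noteq> a" "Y \<noteq> b" "a \<noteq> 0" "b \<noteq> 0"
    using assms(2-5) by auto
  have "(V \<union> {(0, 0), (X, Y)}) \<inter> (W - {(X, Y)} \<union> {(a, b)}) = {}"
    using notin ne W(2) by auto
  from bij_betw_combine[OF bij(1) assms(11) this]
  have 1: "bij_betw corner1 (F \<union> G) ((V \<union> {(0, 0), (X, Y)}) \<union> (W - {(X, Y)} \<union> {(a, b)}))" .
  have disj: "(V \<union> {(X, 0), (0, Y)}) \<inter> (W - {(X, 0), (0, Y)} \<union> {(a, 0), (0, b)}) = {}"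
    using notin ne W(2) by auto
  from bij_betw_combine[OF bij(2) assms(12) this]
  have 2: "bij_betw corner2 (F \<union> G)
      ((V \<union> {(X, 0), (0, Y)}) \<union> (W - {(X, 0), (0, Y)} \<union> {(a, 0), (0, b)}))" .
  from bij_betw_combine[OF bij(3) assms(13) disj]
  have 3: "bij_betw corner3 (F \<union> G)
      ((V \<union> {(X, 0), (0, Y)}) \<union> (W - {(X, 0), (0, Y)} \<union> {(a, 0), (0, b)}))" .
  have "(V \<union> {(0, 0), (X, Y)}) \<union> (W - {(X, Y)} \<union> {(a, b)}) = V \<union> W \<union> {(0, 0), (a, b)}"
    "(V \<union> {(X, 0), (0, Y)}) \<union> (W - {(X, 0), (0, Y)} \<union> {(a, 0), (0, b)}) = V \<union> W \<union> {(a, 0), (0, b)}"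
    using W(1) by auto
  with 1 2 3 have "bij_betw corner1 (F \<union> G) (V \<union> W \<union> {(0, 0), (a, b)})"
    "bij_betw corner2 (F \<union> G) (V \<union> W \<union> {(a, 0), (0, b)})"
    "bij_betw corner3 (F \<union> G) (V \<union> W \<union> {(a, 0), (0, b)})"
    by simp_all
  moreover have "V \<union> W \<subseteq> {0..a} \<times> {0..b} - {(0, 0), (a, 0), (0, b), (a, b)}"
  proof -
    have "(0, 0) \<notin> V"
      using V by auto
    moreover have "V \<subseteq> {0..a} \<times> {0..b}"
      using V assms(3,5) by auto
    ultimately show ?thesis
      using notin W(3) by blast
  qed
  moreover have "finite (F \<union> G)" "\<forall>(x, y, d)\<in>F \<union> G. d \<noteq> 0"
    using F G unfolding tiled_def by blast+
  ultimately show ?thesis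
    unfolding tiled_def by blast
qed

text \<open>Trades the set differences in \<open>tiled_Un\<close> for unions and disjointness, which
  simplification decides on explicit lists.\<close>

lemma bij_betw_set_list:
  assumes "distinct (map f gs)" and "set (map f gs) \<inter> B = {}" and "B \<subseteq> W" and "W \<inter> A = {}" and "A \<inter> B = {}"
    and "set (map f gs) \<union> B = W \<union> A"
  shows "bij_betw f (set gs) (W - B \<union> A)"
proof -
  have "f ` set gs = W - B \<union> A"
    using assms(2-6) by auto
  then show ?thesis
    using assms(1) by (simp add: bij_betw_def distinct_map)
qed

lemma extendsI:
  assumes box: "0 < X" "X < a" "0 < Y" "Y < b"
    and G: "\<forall>(x, y, d)\<in>set gs. d \<noteq> 0"
    and W: "length ws \<le> k" "{(X, Y), (X, 0), (0, Y)} \<subseteq> set ws"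
      "set ws \<subseteq> {0..a} \<times> {0..b} - {(0, 0), (a, 0), (0, b), (a, b)}" "clear (set ws) a b"
    and new: "\<forall>(x, y)\<in>set ws. X < x \<or> Y < y \<or> (x, y) = (X, Y) \<or> (x, y) = (X, 0) \<or> (x, y) = (0, Y) \<or>
      x = X \<and> 2 * Y < 3 * y \<or> y = Y \<and> 2 * X < 3 * x"
    and dist: "distinct (map corner1 gs)" "distinct (map corner2 gs)" "distinct (map corner3 gs)"
    and hole: "set (map corner1 gs) \<inter> {(X, Y)} = {}" "set (map corner2 gs) \<inter> {(X, 0), (0, Y)} = {}"
      "set (map corner3 gs) \<inter> {(X, 0), (0, Y)} = {}"
    and eq: "set (map corner1 gs) \<union> {(X, Y)} = set ws \<union> {(a, b)}"
      "set (map corner2 gs) \<union> {(X, 0), (0, Y)} = set ws \<union> {(a, 0), (0, b)}"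
      "set (map corner3 gs) \<union> {(X, 0), (0, Y)} = set ws \<union> {(a, 0), (0, b)}"
  shows "extends k a b X Y"
  unfolding extends_def
proof (intro allI impI)
  fix F V assume FV: "tiled F V X Y \<and> clear V X Y"
  let ?W = "set ws"
  have V: "V \<subseteq> {0..X} \<times> {0..Y} - {(0, 0), (X, 0), (0, Y), (X, Y)}"
    using FV unfolding tiled_def by blast
  have disj: "?W \<inter> V = {}"
  proof -
    \<comment> \<open>A common point lies in the inner box. By \<open>new\<close> it is then one of
      its corners, which \<open>V\<close> avoids, or it lies in the last third of its top or right
      side, which \<open>clear\<close> forbids to \<open>V\<close>.\<close>
    have False if "(x, y) \<in> ?W" "(x, y) \<in> V" for x y
      using bspec[OF new that(1)] V that(2) FV unfolding clear_def by fastforce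
    then show ?thesis by auto
  qed
  have "tiled (F \<union> set gs) (V \<union> ?W) a b"
  proof (rule tiled_Un[OF _ box _ G W(2) disj W(3)])
    show "bij_betw corner1 (set gs) (?W - {(X, Y)} \<union> {(a, b)})"
      using W(2,3) box by (intro bij_betw_set_list dist hole eq) auto
    show "bij_betw corner2 (set gs) (?W - {(X, 0), (0, Y)} \<union> {(a, 0), (0, b)})"
      using W(2,3) box by (intro bij_betw_set_list dist hole eq) auto
    show "bij_betw corner3 (set gs) (?W - {(X, 0), (0, Y)} \<union> {(a, 0), (0, b)})"
      using W(2,3) box by (intro bij_betw_set_list dist hole eq) auto
  qed (use FV in auto)
  moreover have "clear (V \<union> ?W) a b"
    using V W(4) box unfolding clear_def by force
  moreover have "card ?W \<le> k"
    using W(1) card_length le_trans by blast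
  ultimately show "\<exists>F' W. tiled F' (V \<union> W) a b \<and> clear (V \<union> W) a b \<and> finite W \<and> card W \<le> k"
    by blast
qed

section \<open>Three explicit halvings of a nearly square box\<close>

text \<open>With \<open>x\<close> to the right and \<open>y\<close> upwards, three squares, each cut
  into two triangles, surround the inner box: two of side \<open>c\<close> on top and one of side
  \<open>c + e\<close> at the lower right. The half-perimeter drops from \<open>4 * c + e\<close> to
  \<open>2 * c\<close>, while the difference of the sides doubles.\<close>

lemma extends_6:
  fixes c e :: int
  assumes "e \<noteq> 0" and "3 * \<bar>e\<bar> < c"
  shows "extends 6 (2 * c) (2 * c + e) (c - e) (c + e)"
proof -
  have "c > 3 * e" "c > - 3 * e" using assms by auto
  with assms(1) show ?thesis
    by (intro extendsI[where gs = "[(0, c + e, c), (c, 2 * c + e, - c), (c, c + e, c), (2 * c, 2 * c + e, - c),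
          (2 * c, c + e, - (c + e)), (c - e, 0, c + e)]"
        and ws = "[(0, c + e), (c, 2 * c + e), (c, c + e), (2 * c, c + e), (c - e, 0), (c - e, c + e)]"])
      (simp_all add: corner_defs clear_def algebra_simps insert_commute)
qed

text \<open>The arrangement of \<open>extends_6\<close> with the upper right corner of the inner box
  moved by \<open>(- e, e)\<close>: two triangles change their legs by \<open>e\<close>, and two
  small triangles of leg \<open>e\<close> or \<open>- e\<close> compensate. The point is that for
  even \<open>c\<close> both inner sides are even.\<close>

lemma extends_8:
  fixes c e :: int
  assumes "e \<noteq> 0" and "3 * \<bar>e\<bar> < c"
  shows "extends 8 (2 * c) (2 * c + e) (c - 2 * e) (c + 2 * e)"
proof -
  have "c > 3 * e" "c > - 3 * e" using assms by auto
  with assms(1) show ?thesis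
    by (intro extendsI[where gs = "[(0, c + 2 * e, c - e), (c, 2 * c + e, - c), (c, c + e, c), (2 * c, 2 * c + e, - c),
          (2 * c, c + e, - (c + e)), (c - 2 * e, 0, c + 2 * e), (c - e, c + 2 * e, - e), (c - e, c + e, e)]"
        and ws = "[(0, c + 2 * e), (c, 2 * c + e), (c, c + e), (2 * c, c + e), (c - 2 * e, 0),
          (c - e, c + 2 * e), (c - e, c + e), (c - 2 * e, c + 2 * e)]"])
      (simp_all add: corner_defs clear_def algebra_simps insert_commute, auto)
qed

text \<open>Squares of sides \<open>h - e\<close>, \<open>h\<close> and \<open>h + e\<close> and the
  inner box form a pinwheel around a square of side \<open>\<bar>e\<bar>\<close>; each square is cut
  into two triangles.\<close>

lemma extends_8_even:
  fixes h e :: int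
  assumes "e \<noteq> 0" and "3 * \<bar>e\<bar> < h"
  shows "extends 8 (2 * h - e) (2 * h + e) (h - 2 * e) (h + 2 * e)"
proof -
  have "h > 3 * e" "h > - 3 * e" using assms by auto
  with assms(1) show ?thesis
    by (intro extendsI[where gs = "[(0, h + 2 * e, h - e), (h - e, 2 * h + e, - (h - e)), (h - e, h + e, h),
          (2 * h - e, 2 * h + e, - h), (2 * h - e, h + e, - (h + e)), (h - 2 * e, 0, h + e),
          (h - 2 * e, h + e, e), (h - e, h + 2 * e, - e)]"
        and ws = "[(0, h + 2 * e), (h - e, 2 * h + e), (h - e, h + e), (2 * h - e, h + e), (h - 2 * e, 0),
          (h - 2 * e, h + e), (h - e, h + 2 * e), (h - 2 * e, h + 2 * e)]"])
      (simp_all add: corner_defs clear_def algebra_simps insert_commute, auto)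
qed

section \<open>Filling a box by squares, and scaling\<close>

lemma tiled_square: "0 < a \<Longrightarrow> tiled {(0, 0, a), (a, a, - a)} {} a a"
  by (auto simp: tiled_def bij_betw_def corner_defs)

text \<open>A square of two triangles is put on top of the box, whose two upper corners become
  ordinary points.\<close>

lemma tiled_taller:
  assumes F: "tiled F V a c" and "0 < a" and "0 < c"
  shows "tiled (F \<union> {(0, c, a), (a, c + a, - a)}) (V \<union> {(0, c), (a, c)}) a (c + a)"
proof -
  have V: "V \<subseteq> {0..a} \<times> {0..c} - {(0, 0), (a, 0), (0, c), (a, c)}" "finite F" "\<forall>(x, y, d)\<in>F. d \<noteq> 0"
    and bij: "bij_betw corner1 F (V \<union> {(0, 0), (a, c)})"
      "bij_betw corner2 F (V \<union> {(a, 0), (0, c)})" "bij_betw corner3 F (V \<union> {(a, 0), (0, c)})"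
    using F unfolding tiled_def by blast+
  let ?G = "{(0, c, a), (a, c + a, - a)} :: (int \<times> int \<times> int) set"
  have "bij_betw corner1 ?G {(0, c), (a, c + a)}" "bij_betw corner2 ?G {(a, c), (0, c + a)}"
    "bij_betw corner3 ?G {(a, c), (0, c + a)}"
    using assms(2,3) by (auto simp: bij_betw_def corner_defs)
  moreover have notin: "(0, c + a) \<notin> V" "(a, c + a) \<notin> V" "(0, c) \<notin> V" "(a, c) \<notin> V" "(0, 0) \<notin> V" "(a, 0) \<notin> V"
    using V(1) assms(2,3) by auto
  ultimately have "bij_betw corner1 (F \<union> ?G) ((V \<union> {(0, 0), (a, c)}) \<union> {(0, c), (a, c + a)})"
    "bij_betw corner2 (F \<union> ?G) ((V \<union> {(a, 0), (0, c)}) \<union> {(a, c), (0, c + a)})"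
    "bij_betw corner3 (F \<union> ?G) ((V \<union> {(a, 0), (0, c)}) \<union> {(a, c), (0, c + a)})"
    using assms(2,3) by (intro bij_betw_combine bij; force)+
  moreover have "(V \<union> {(0, 0), (a, c)}) \<union> {(0, c), (a, c + a)} = V \<union> {(0, c), (a, c)} \<union> {(0, 0), (a, c + a)}"
    "(V \<union> {(a, 0), (0, c)}) \<union> {(a, c), (0, c + a)} = V \<union> {(0, c), (a, c)} \<union> {(a, 0), (0, c + a)}"
    by auto
  moreover have "V \<subseteq> {0..a} \<times> {0..c + a}"
    using V(1) assms(2) by auto
  then have "V \<union> {(0, c), (a, c)} \<subseteq> {0..a} \<times> {0..c + a} - {(0, 0), (a, 0), (0, c + a), (a, c + a)}"
    using notin assms(2,3) by auto
  ultimately show ?thesis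
    using V(2,3) assms(2) unfolding tiled_def by auto
qed

text \<open>The Euclidean algorithm: a largest square is split off until the box is itself a square.
  No bound on \<open>V\<close> is asked for.\<close>

lemma tiled_exists: "0 < a \<Longrightarrow> 0 < b \<Longrightarrow> \<exists>F V. tiled F V a b"
proof (induction "nat (a + b)" arbitrary: a b rule: less_induct)
  case less
  consider "a = b" | "a < b" | "b < a" by linarith
  then show ?case
  proof cases
    case 1
    then show ?thesis using tiled_square less.prems by blast
  next
    case 2
    then obtain F V where "tiled F V a (b - a)"
      using less.hyps[of a "b - a"] less.prems by auto
    from tiled_taller[OF this] show ?thesis
      using 2 less.prems by auto
  next
    case 3
    then obtain F V where "tiled F V b (a - b)"
      using less.hyps[of b "a - b"] less.prems by auto
    from tiled_taller[OF this] have "\<exists>F V. tiled F V b a"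
      using 3 less.prems by auto
    then show ?thesis using tiled_swap by blast
  qed
qed

text \<open>With a square on top, no point of \<open>V\<close> is on the upper side, and those on
  the right side have height at most \<open>b - a\<close>, which is at most two thirds of
  \<open>b\<close>.\<close>

lemma tiled_clear_exists:
  assumes "0 < a" "a < b" "b \<le> 3 * a"
  shows "\<exists>F V. tiled F V a b \<and> clear V a b"
proof -
  obtain F V where F: "tiled F V a (b - a)"
    using tiled_exists[of a "b - a"] assms by auto
  then have V: "V \<subseteq> {0..a} \<times> {0..b - a}"
    unfolding tiled_def by blast
  have "clear (V \<union> {(0, b - a), (a, b - a)}) a b"
    using V assms unfolding clear_def by auto
  then show ?thesis
    using tiled_taller[OF F] assms by auto
qed

lemma tiled_scale:
  assumes F: "tiled F V a b" and u: "0 < u"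
  shows "tiled ((\<lambda>(x, y, d). (u * x, u * y, u * d)) ` F) ((\<lambda>(x, y). (u * x, u * y)) ` V) (u * a) (u * b)"
proof -
  let ?s = "\<lambda>(x, y, d). (u * x, u * y, u * d)" and ?t = "\<lambda>(x, y). (u * x, u * y)"
  have transfer: "bij_betw f (?s ` F) (?t ` B)"
    if "bij_betw f F B" and "\<And>t. f (?s t) = ?t (f t)" for f B
  proof -
    have "bij_betw (?t \<circ> f) F (?t ` B)"
      using that(1) u by (intro bij_betw_trans[of f F B]) (auto simp: bij_betw_def inj_on_def)
    then have "bij_betw (f \<circ> ?s) F (?t ` B)"
      using that(2) by (simp add: o_def)
    moreover have "bij_betw ?s F (?s ` F)"
      using u by (auto simp: bij_betw_def inj_on_def)
    ultimately show ?thesis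
      using bij_betw_comp_iff by blast
  qed
  have "bij_betw corner1 (?s ` F) (?t ` (V \<union> {(0, 0), (a, b)}))"
    "bij_betw corner2 (?s ` F) (?t ` (V \<union> {(a, 0), (0, b)}))"
    "bij_betw corner3 (?s ` F) (?t ` (V \<union> {(a, 0), (0, b)}))"
    using F unfolding tiled_def by (intro transfer; auto simp: corner_defs algebra_simps)+
  moreover have "finite (?s ` F)" "\<forall>(x, y, d)\<in>?s ` F. d \<noteq> 0"
    using F u unfolding tiled_def by auto
  moreover have "?t ` V \<subseteq> {0..u * a} \<times> {0..u * b} - {(0, 0), (u * a, 0), (0, u * b), (u * a, u * b)}"
  proof -
    have "V \<subseteq> {0..a} \<times> {0..b} - {(0, 0), (a, 0), (0, b), (a, b)}"
      using F unfolding tiled_def by blast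
    then show ?thesis using u by auto
  qed
  ultimately show ?thesis
    unfolding tiled_def by (simp add: image_Un)
qed

lemma clear_scale:
  assumes "clear V a b" and u: "0 < (u :: int)"
  shows "clear ((\<lambda>(x, y). (u * x, u * y)) ` V) (u * a) (u * b)"
  using assms by (auto simp: clear_def mult.left_commute[of 3] mult.left_commute[of 2])

section \<open>Descent to a small box, up to powers of two\<close>

lemma extends_mono: "extends k a b X Y \<Longrightarrow> k \<le> l \<Longrightarrow> extends l a b X Y"
  unfolding extends_def by (meson le_trans)

text \<open>The power of two is free of charge, since it is undone modulo \<open>n\<close> in the end.\<close>

definition reduces :: "int \<Rightarrow> nat \<Rightarrow> int \<Rightarrow> int \<Rightarrow> bool" where
  "reduces t k a b \<longleftrightarrow> (\<exists>j X Y. 0 < X \<and> 0 < Y \<and> X + Y \<le> t \<and>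
     (X < Y \<and> Y \<le> 3 * X \<or> Y < X \<and> X \<le> 3 * Y) \<and> extends k a b (2 ^ j * X) (2 ^ j * Y))"

lemma reduces_step: "extends k a b c d \<Longrightarrow> reduces t l c d \<Longrightarrow> reduces t (k + l) a b"
  unfolding reduces_def using extends_trans by blast

lemma reduces_mono: "reduces t k a b \<Longrightarrow> k \<le> l \<Longrightarrow> reduces t l a b"
  unfolding reduces_def using extends_mono by blast

lemma two_power_times_odd:
  assumes "(0 :: int) < c"
  obtains v q where "c = 2 ^ v * q" "odd q" "0 < q"
proof -
  have "\<exists>v q. c = 2 ^ v * q \<and> odd q \<and> 0 < q"
    using assms
  proof (induction "nat c" arbitrary: c rule: less_induct)
    case less
    show ?case
    proof (cases "even c")
      case True
      then obtain b where b: "c = 2 * b" by blast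
      then obtain v q where "b = 2 ^ v * q" "odd q" "0 < q"
        using less.hyps[of b] less.prems by auto
      then show ?thesis using b by (intro exI[of _ "Suc v"] exI[of _ q]) simp
    next
      case False
      then show ?thesis using less.prems by (intro exI[of _ 0] exI[of _ c]) simp
    qed
  qed
  then show ?thesis using that by blast
qed

text \<open>The index \<open>i\<close> stands for half-perimeters up to \<open>2 ^ i * t\<close>,
  apart from a common factor \<open>2 ^ j\<close> of the sides. \<open>odd_cost\<close> is for sides
  \<open>(s - g) div 2\<close> and \<open>(s + g) div 2\<close> with \<open>s\<close> odd,
  \<open>even_cost\<close> for \<open>4 ^ r * q - g\<close> and
  \<open>4 ^ r * q + g\<close>.\<close>

definition odd_cost :: "nat \<Rightarrow> nat" where "odd_cost i = (if i = 0 then 0 else 5 * i + 4)"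

definition even_cost :: "nat \<Rightarrow> nat" where "even_cost i = (if i = 0 then 0 else 5 * i + 3)"

text \<open>The sides differ by 1 and exactly one of them is \<open>2 * c\<close>. If it is the
  first, the halvings apply with \<open>e\<close> a multiple of \<open>g\<close>; otherwise their
  mirror images apply with \<open>- g\<close>.\<close>

lemma extends_quarter:
  fixes s c g :: int
  assumes "g = 1 \<or> g = - 1" and "s = 4 * c + 1 \<or> s = 4 * c - 1" and "3 < c"
  shows "extends 6 (2 ^ j * ((s - g) div 2)) (2 ^ j * ((s + g) div 2)) (2 ^ j * (c - g)) (2 ^ j * (c + g))"
    and "extends 8 (2 ^ j * ((s - g) div 2)) (2 ^ j * ((s + g) div 2)) (2 ^ j * (c - 2 * g)) (2 ^ j * (c + 2 * g))"
proof -
  let ?u = "2 ^ j :: int"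
  have u: "?u * g \<noteq> 0" "3 * \<bar>?u * g\<bar> < ?u * c" "?u * - g \<noteq> 0" "3 * \<bar>?u * - g\<bar> < ?u * c"
    using assms(1,3) by (auto simp: abs_mult)
  consider "s = 4 * c + g" | "s = 4 * c - g" using assms(1,2) by auto
  then have "extends 6 (?u * ((s - g) div 2)) (?u * ((s + g) div 2)) (?u * (c - g)) (?u * (c + g)) \<and>
    extends 8 (?u * ((s - g) div 2)) (?u * ((s + g) div 2)) (?u * (c - 2 * g)) (?u * (c + 2 * g))"
  proof cases
    case 1
    then have eq: "(s - g) div 2 = 2 * c" "(s + g) div 2 = 2 * c + g" by auto
    have "extends 6 (?u * (2 * c)) (?u * (2 * c + g)) (?u * (c - g)) (?u * (c + g)) \<and>
      extends 8 (?u * (2 * c)) (?u * (2 * c + g)) (?u * (c - 2 * g)) (?u * (c + 2 * g))"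
      using extends_6[OF u(1,2)] extends_8[OF u(1,2)] by (simp add: algebra_simps)
    then show ?thesis by (simp only: eq)
  next
    case 2
    then have eq: "(s - g) div 2 = 2 * c - g" "(s + g) div 2 = 2 * c" by auto
    have "extends 6 (?u * (2 * c - g)) (?u * (2 * c)) (?u * (c - g)) (?u * (c + g)) \<and>
      extends 8 (?u * (2 * c - g)) (?u * (2 * c)) (?u * (c - 2 * g)) (?u * (c + 2 * g))"
      using extends_swap[OF extends_6[OF u(3,4)]] extends_swap[OF extends_8[OF u(3,4)]]
      by (simp add: algebra_simps)
    then show ?thesis by (simp only: eq)
  qed
  then show "extends 6 (?u * ((s - g) div 2)) (?u * ((s + g) div 2)) (?u * (c - g)) (?u * (c + g))"
    "extends 8 (?u * ((s - g) div 2)) (?u * ((s + g) div 2)) (?u * (c - 2 * g)) (?u * (c + 2 * g))"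
    by auto
qed

text \<open>
  Only the step from the first family to the second descends a single level, at a cost of 6; all
  other steps descend two levels at a cost of at most 8.  This accounts for the offset between the
  two costs.
\<close>

lemma reduces_near_rhombus:
  fixes t :: int
  assumes t: "32 \<le> t"
  shows "(\<forall>j s g. odd s \<and> 3 \<le> s \<and> s \<le> 2 ^ i * t \<and> (g = 1 \<or> g = - 1) \<longrightarrow>
      reduces t (odd_cost i) (2 ^ j * ((s - g) div 2)) (2 ^ j * ((s + g) div 2))) \<and>
    (\<forall>j r q g. odd q \<and> 0 < q \<and> 0 < r \<and> 2 * (4 ^ r * q) \<le> 2 ^ i * t \<and> (g = 1 \<or> g = - 1) \<longrightarrow>
      reduces t (even_cost i) (2 ^ j * (4 ^ r * q - g)) (2 ^ j * (4 ^ r * q + g)))"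
    (is "?A i \<and> ?B i")
proof (induction i rule: less_induct)
  case (less i)
  have half: "2 ^ i * t = 2 * (2 ^ (i - 1) * t)" if "0 < i"
    using that by (cases i) auto
  \<comment> \<open>For \<open>i = 1\<close> the difference \<open>i - 2\<close> is 0, and
    \<open>4 * b \<le> 2 * t + 1\<close> still gives \<open>b \<le> t\<close>. The summand 1 allows
    for \<open>s = 4 * c - 1\<close>.\<close>
  have quarter: "b \<le> 2 ^ (i - 2) * t" if "0 < i" "4 * b \<le> 2 ^ i * t + 1" for b
  proof (cases "i = 1")
    case True
    then show ?thesis using that t by auto
  next
    case False
    define l where "l = i - 2"
    have "i = Suc (Suc l)" using that(1) False by (simp add: l_def)
    then have "2 ^ i * t = 4 * (2 ^ l * t)" by simp
    then show ?thesis using that(2) unfolding l_def by linarith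
  qed
  have IH_odd: "reduces t (odd_cost l) (2 ^ j * ((s - g) div 2)) (2 ^ j * ((s + g) div 2))"
    if "l < i" "odd s" "3 \<le> s" "s \<le> 2 ^ l * t" "g = 1 \<or> g = - 1" for l j and s g :: int
    using less.IH[OF that(1)] that(2-) by blast
  have IH_even: "reduces t (even_cost l) (2 ^ j * (4 ^ r * q - g)) (2 ^ j * (4 ^ r * q + g))"
    if "l < i" "odd q" "0 < q" "0 < r" "2 * (4 ^ r * q) \<le> 2 ^ l * t" "g = 1 \<or> g = - 1"
    for l j r and q g :: int
    using less.IH[OF that(1)] that(2-) by blast
  \<comment> \<open>For odd \<open>q\<close> both sides are even; taking out the factor 2 halves the
    half-perimeter from \<open>2 * q\<close> to \<open>q\<close> and leads to the odd
    family.\<close>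
  have odd_step: "reduces t (odd_cost (i - 2)) (2 ^ j * (q - g)) (2 ^ j * (q + g))"
    if "0 < i" "odd q" "3 \<le> q" "4 * q \<le> 2 ^ i * t + 1" "g = 1 \<or> g = - 1" for j q and g :: int
  proof -
    have "q - g = 2 * ((q - g) div 2)" "q + g = 2 * ((q + g) div 2)"
      using that(2,5) by presburger+
    moreover have "reduces t (odd_cost (i - 2)) (2 ^ Suc j * ((q - g) div 2)) (2 ^ Suc j * ((q + g) div 2))"
      using that quarter[OF that(1,4)] by (intro IH_odd) auto
    moreover have "2 ^ Suc j * b = 2 ^ j * (2 * b)" for b :: int
      by simp
    ultimately show ?thesis by metis
  qed
  have even_step: "reduces t (even_cost (i - 2)) (2 ^ j * (4 ^ r * q - g)) (2 ^ j * (4 ^ r * q + g))"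
    if "0 < i" "odd q" "0 < q" "0 < r" "8 * (4 ^ r * q) \<le> 2 ^ i * t + 1" "g = 1 \<or> g = - 1" for j r q and g :: int
    using that quarter[of "2 * (4 ^ r * q)"] by (intro IH_even) auto
  have "?A i"
  proof (intro allI impI)
    fix j and s g :: int
    assume s: "odd s \<and> 3 \<le> s \<and> s \<le> 2 ^ i * t \<and> (g = 1 \<or> g = - 1)"
    show "reduces t (odd_cost i) (2 ^ j * ((s - g) div 2)) (2 ^ j * ((s + g) div 2))"
    proof (cases "s \<le> t")
      case True
      have "extends 0 (2 ^ j * ((s - g) div 2)) (2 ^ j * ((s + g) div 2))
          (2 ^ j * ((s - g) div 2)) (2 ^ j * ((s + g) div 2))"
        by (rule extends_refl)
      moreover obtain b where "s = 2 * b + 1" using s by (meson oddE)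
      ultimately have "reduces t 0 (2 ^ j * ((s - g) div 2)) (2 ^ j * ((s + g) div 2))"
        unfolding reduces_def using s True
        by (intro exI[of _ j] exI[of _ "(s - g) div 2"] exI[of _ "(s + g) div 2"]) auto
      then show ?thesis by (rule reduces_mono) simp
    next
      case False
      have i: "0 < i" using False s by (cases i) auto
      obtain c where c: "s = 4 * c + 1 \<or> s = 4 * c - 1"
      proof -
        have "s mod 4 = 1 \<or> s mod 4 = 3" using s by presburger
        then have "s = 4 * (s div 4) + 1 \<or> s = 4 * (s div 4 + 1) - 1" by presburger
        then show ?thesis using that by blast
      qed
      have c3: "7 < c" and cs: "4 * c \<le> 2 ^ i * t + 1" using c s False t by auto
      have ext: "extends 6 (2 ^ j * ((s - g) div 2)) (2 ^ j * ((s + g) div 2)) (2 ^ j * (c - g)) (2 ^ j * (c + g))"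
        "extends 8 (2 ^ j * ((s - g) div 2)) (2 ^ j * ((s + g) div 2)) (2 ^ j * (c - 2 * g)) (2 ^ j * (c + 2 * g))"
        using extends_quarter[of g s c j] c c3 s by auto
      obtain v q where q: "c = 2 ^ v * q" "odd q" "0 < q"
        using two_power_times_odd[of c] c3 by auto
      \<comment> \<open>The parity of the exponent of two in \<open>c\<close> selects the inner box:
        sides \<open>c - g\<close> and \<open>c + g\<close> if it is even, \<open>c - 2 * g\<close>
        and \<open>c + 2 * g\<close> if it is odd. Either way the result is in one of the two
        families, up to a factor 2.\<close>
      obtain r where "v = 2 * r \<or> v = 2 * r + 1"
        by (metis evenE oddE)
      then consider (even) "c = 4 ^ r * q" | (odd) "c = 2 * (4 ^ r * q)"
        using q(1) by (auto simp: power_mult)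
      then show ?thesis
      proof cases
        case even
        show ?thesis
        proof (cases "r = 0")
          case True
          then have "reduces t (odd_cost (i - 2)) (2 ^ j * (c - g)) (2 ^ j * (c + g))"
            using odd_step[of c g j] i even q(2) c3 cs s by simp
          from reduces_step[OF ext(1) this] show ?thesis
            by (rule reduces_mono) (use i in \<open>auto simp: odd_cost_def\<close>)
        next
          case False
          \<comment> \<open>Here \<open>c\<close> is even, so \<open>c - g\<close> and
            \<open>c + g\<close> are odd and no factor 2 comes out: only one level is
            gained.\<close>
          have "2 * c \<le> 2 ^ (i - 1) * t"
            using cs half[OF i] by linarith
          then have "reduces t (even_cost (i - 1)) (2 ^ j * (c - g)) (2 ^ j * (c + g))"
            unfolding even using i even q(2,3) False s by (intro IH_even) auto
          from reduces_step[OF ext(1) this] show ?thesis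
            by (rule reduces_mono) (use i in \<open>auto simp: odd_cost_def even_cost_def\<close>)
        qed
      next
        case odd
        then have eq: "2 ^ j * (c - 2 * g) = 2 ^ Suc j * (4 ^ r * q - g)"
          "2 ^ j * (c + 2 * g) = 2 ^ Suc j * (4 ^ r * q + g)"
          by (auto simp: algebra_simps)
        show ?thesis
        proof (cases "r = 0")
          case True
          then have "reduces t (odd_cost (i - 2)) (2 ^ Suc j * (4 ^ r * q - g)) (2 ^ Suc j * (4 ^ r * q + g))"
            using odd_step[of q g "Suc j"] i odd q(2) c3 cs s by simp
          from reduces_step[OF ext(2)[unfolded eq] this] show ?thesis
            by (rule reduces_mono) (use i in \<open>auto simp: odd_cost_def\<close>)
        next
          case False
          have "reduces t (even_cost (i - 2)) (2 ^ Suc j * (4 ^ r * q - g)) (2 ^ Suc j * (4 ^ r * q + g))"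
            using i odd q(2,3) False cs s by (intro even_step) auto
          from reduces_step[OF ext(2)[unfolded eq] this] show ?thesis
            by (rule reduces_mono) (use i in \<open>auto simp: odd_cost_def even_cost_def\<close>)
        qed
      qed
    qed
  qed
  moreover have "?B i"
  proof (intro allI impI)
    fix j r and q g :: int
    assume q: "odd q \<and> 0 < q \<and> 0 < r \<and> 2 * (4 ^ r * q) \<le> 2 ^ i * t \<and> (g = 1 \<or> g = - 1)"
    let ?x = "4 ^ r * q"
    obtain r' where r: "r = Suc r'" using q by (cases r) auto
    define y where "y = 4 ^ r' * q"
    have xy: "?x = 4 * y" using r by (simp add: y_def)
    have y: "0 < y" using q by (simp add: y_def)
    show "reduces t (even_cost i) (2 ^ j * (?x - g)) (2 ^ j * (?x + g))"
    proof (cases "2 * ?x \<le> t")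
      case True
      have "extends 0 (2 ^ j * (?x - g)) (2 ^ j * (?x + g)) (2 ^ j * (?x - g)) (2 ^ j * (?x + g))"
        by (rule extends_refl)
      then have "reduces t 0 (2 ^ j * (?x - g)) (2 ^ j * (?x + g))"
        unfolding reduces_def using q True xy y
        by (intro exI[of _ j] exI[of _ "?x - g"] exI[of _ "?x + g"]) auto
      then show ?thesis by (rule reduces_mono) simp
    next
      case False
      have i: "0 < i" using False q by (cases i) auto
      have y4: "4 < y" using False xy t by linarith
      \<comment> \<open>The halving is applied with \<open>h = 2 * y\<close>, up to the factor
        \<open>2 ^ j\<close>. Both inner sides are then even, so that taking out 2 brings the
        half-perimeter from \<open>8 * y\<close> to \<open>2 * y\<close>.\<close>
      have "2 ^ j * g \<noteq> 0" "3 * \<bar>2 ^ j * g\<bar> < 2 ^ j * (2 * y)"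
        using q y4 by (auto simp: abs_mult)
      from extends_8_even[OF this]
      have ext: "extends 8 (2 ^ j * (?x - g)) (2 ^ j * (?x + g)) (2 ^ Suc j * (y - g)) (2 ^ Suc j * (y + g))"
        unfolding xy by (simp add: algebra_simps)
      show ?thesis
      proof (cases "r' = 0")
        case True
        then have "reduces t (odd_cost (i - 2)) (2 ^ Suc j * (y - g)) (2 ^ Suc j * (y + g))"
          using q i y4 xy by (intro odd_step) (auto simp: y_def)
        from reduces_step[OF ext this] show ?thesis
          by (rule reduces_mono) (use i in \<open>auto simp: odd_cost_def even_cost_def\<close>)
      next
        case False
        then have "reduces t (even_cost (i - 2)) (2 ^ Suc j * (y - g)) (2 ^ Suc j * (y + g))"
          using q i xy unfolding y_def by (intro even_step) auto
        from reduces_step[OF ext this] show ?thesis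
          by (rule reduces_mono) (use i in \<open>auto simp: even_cost_def\<close>)
      qed
    qed
  qed
  ultimately show ?case by blast
qed

section \<open>From triangles on the torus to Latin trades\<close>

definition residue :: "nat \<Rightarrow> int \<times> int \<Rightarrow> int \<times> int" where
  "residue n = (\<lambda>(x, y). (x mod int n, y mod int n))"

definition sum_entry :: "nat \<Rightarrow> int \<times> int \<Rightarrow> entry" where
  "sum_entry n = (\<lambda>(x, y). (nat x, nat y, nat ((x + y) mod int n)))"

text \<open>\<open>T'\<close> puts \<open>x + y + d\<close> into the cell \<open>(x, y)\<close>. In
  the addition table this symbol stands in row \<open>x\<close> at the second corner and in column
  \<open>y\<close> at the third. So the three bijections preserve the cells and the symbols of rows
  and columns, and injectivity makes \<open>T'\<close> a partial Latin square.\<close>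

lemma latin_trade_of_tiles:
  assumes n: "0 < n" and S: "S \<subseteq> {0..<int n} \<times> {0..<int n}" "S \<noteq> {}"
    and bij: "bij_betw (residue n \<circ> corner1) F S" "bij_betw (residue n \<circ> corner2) F S"
      "bij_betw (residue n \<circ> corner3) F S"
    and d: "\<forall>(x, y, d)\<in>F. \<not> int n dvd d"
  shows "latin_trade_in n (add_table n) (sum_entry n ` S)"
proof -
  define T where "T = sum_entry n ` S"
  define T' where "T' = (\<lambda>(x, y, d). (nat (x mod int n), nat (y mod int n), nat ((x + y + d) mod int n))) ` F"
  have T: "(r, c, s) \<in> T \<longleftrightarrow> (int r, int c) \<in> S \<and> int s = (int r + int c) mod int n" for r c s
  proof
    assume "(r, c, s) \<in> T"
    then obtain x y where "(x, y) \<in> S" "r = nat x" "c = nat y" "s = nat ((x + y) mod int n)"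
      unfolding T_def sum_entry_def by auto
    then show "(int r, int c) \<in> S \<and> int s = (int r + int c) mod int n"
      using S(1) n by auto
  next
    assume "(int r, int c) \<in> S \<and> int s = (int r + int c) mod int n"
    then show "(r, c, s) \<in> T"
      unfolding T_def sum_entry_def by (intro image_eqI[of _ _ "(int r, int c)"]) (auto dest: sym)
  qed
  have T': "(r, c, s) \<in> T' \<longleftrightarrow> (\<exists>x y d. (x, y, d) \<in> F \<and> int r = x mod int n \<and> int c = y mod int n \<and>
      int s = (x + y + d) mod int n)" for r c s
    unfolding T'_def using n by (force simp: nat_eq_iff intro!: rev_image_eqI)
  have img: "(residue n \<circ> corner1) ` F = S" "(residue n \<circ> corner2) ` F = S" "(residue n \<circ> corner3) ` F = S"
    using bij by (auto simp: bij_betw_def)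
  have inj: "t = t'" if "t \<in> F" "t' \<in> F" "residue n (corner1 t) = residue n (corner1 t') \<or>
      residue n (corner2 t) = residue n (corner2 t') \<or> residue n (corner3 t) = residue n (corner3 t')" for t t'
    using that bij unfolding bij_betw_def inj_on_def by auto
  have bound: "int r = z mod int n \<Longrightarrow> r < n" for r z
    using n by (metis of_nat_0_less_iff of_nat_less_iff pos_mod_bound)
  have "pls n T"
    unfolding pls_def
  proof (intro conjI allI impI subsetI)
    fix t assume t: "t \<in> T"
    obtain r c s where "t = (r, c, s)" by (cases t)
    with t T[of r c s] have "(int r, int c) \<in> S" "int s = (int r + int c) mod int n" by auto
    then show "t \<in> {..<n} \<times> {..<n} \<times> {..<n}"
      using S(1) bound \<open>t = (r, c, s)\<close> by auto
  next
    fix r c s s' assume "(r, c, s) \<in> T \<and> (r, c, s') \<in> T"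
    then show "s = s'" unfolding T by auto
  next
    fix r c c' s assume "(r, c, s) \<in> T \<and> (r, c', s) \<in> T"
    then have "(int r + int c) mod int n = (int r + int c') mod int n" "int c < int n" "int c' < int n"
      unfolding T using S(1) by auto
    then show "c = c'"
      by (metis add_diff_cancel_left' mod_diff_left_eq mod_pos_pos_trivial of_nat_0_le_iff of_nat_eq_iff)
  next
    fix r r' c s assume "(r, c, s) \<in> T \<and> (r', c, s) \<in> T"
    then have "(int r + int c) mod int n = (int r' + int c) mod int n" "int r < int n" "int r' < int n"
      unfolding T using S(1) by auto
    then show "r = r'"
      by (metis add_diff_cancel_right' mod_diff_left_eq mod_pos_pos_trivial of_nat_0_le_iff of_nat_eq_iff)
  qed
  moreover have "T \<subseteq> add_table n"
  proof
    fix t assume t: "t \<in> T"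
    obtain r c s where rcs: "t = (r, c, s)" by (cases t)
    with t T[of r c s] have "(int r, int c) \<in> S" "int s = (int r + int c) mod int n" by auto
    then have "r < n" "c < n" "s = (r + c) mod n"
      using S(1) by (auto simp flip: of_nat_add of_nat_mod)
    then show "t \<in> add_table n"
      using rcs unfolding add_table_def by blast
  qed
  moreover have "T \<noteq> {}" using S(2) unfolding T_def by simp
  moreover have "pls n T'"
    unfolding pls_def
  proof (intro conjI allI impI subsetI)
    fix t assume t: "t \<in> T'"
    obtain r c s where "t = (r, c, s)" by (cases t)
    with t T'[of r c s] show "t \<in> {..<n} \<times> {..<n} \<times> {..<n}"
      using bound by auto
  next
    fix r c s s' assume "(r, c, s) \<in> T' \<and> (r, c, s') \<in> T'"
    then obtain x y d x' y' d' where *: "(x, y, d) \<in> F" "(x', y', d') \<in> F"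
      "x mod int n = x' mod int n" "y mod int n = y' mod int n"
      "int s = (x + y + d) mod int n" "int s' = (x' + y' + d') mod int n"
      unfolding T' by metis
    then have "(x, y, d) = (x', y', d')"
      by (intro inj) (auto simp: residue_def corner_defs)
    then show "s = s'" using * by simp
  next
    fix r c c' s assume "(r, c, s) \<in> T' \<and> (r, c', s) \<in> T'"
    then obtain x y d x' y' d' where *: "(x, y, d) \<in> F" "(x', y', d') \<in> F"
      "x mod int n = x' mod int n" "int c = y mod int n" "int c' = y' mod int n"
      "(x + y + d) mod int n = (x' + y' + d') mod int n"
      unfolding T' by metis
    have "(y + d) mod int n = (x + y + d - x) mod int n" by (simp add: algebra_simps)
    also have "\<dots> = (x' + y' + d' - x') mod int n"
      using *(3,6) by (rule mod_diff_cong[OF _ _, rotated])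
    finally have "(y + d) mod int n = (y' + d') mod int n" by simp
    with * have "(x, y, d) = (x', y', d')"
      by (intro inj) (auto simp: residue_def corner_defs)
    then show "c = c'" using * by simp
  next
    fix r r' c s assume "(r, c, s) \<in> T' \<and> (r', c, s) \<in> T'"
    then obtain x y d x' y' d' where *: "(x, y, d) \<in> F" "(x', y', d') \<in> F"
      "y mod int n = y' mod int n" "int r = x mod int n" "int r' = x' mod int n"
      "(x + y + d) mod int n = (x' + y' + d') mod int n"
      unfolding T' by metis
    have "(x + d) mod int n = (x + y + d - y) mod int n" by (simp add: algebra_simps)
    also have "\<dots> = (x' + y' + d' - y') mod int n"
      using *(3,6) by (rule mod_diff_cong[OF _ _, rotated])
    finally have "(x + d) mod int n = (x' + d') mod int n" by simp
    with * have "(x, y, d) = (x', y', d')"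
      by (intro inj) (auto simp: residue_def corner_defs)
    then show "r = r'" using * by simp
  qed
  moreover have "T \<inter> T' = {}"
  proof -
    have False if "(r, c, s) \<in> T" "(r, c, s) \<in> T'" for r c s
    proof -
      obtain x y d where *: "(x, y, d) \<in> F" "int r = x mod int n" "int c = y mod int n"
        "int s = (x + y + d) mod int n"
        using \<open>(r, c, s) \<in> T'\<close> unfolding T' by metis
      moreover have "int s = (int r + int c) mod int n"
        using \<open>(r, c, s) \<in> T\<close> unfolding T by auto
      ultimately have "(x + y + d) mod int n = (x + y) mod int n"
        by (metis mod_add_eq)
      then have "int n dvd d"
        by (metis add_diff_cancel_left' mod_eq_dvd_iff)
      then show False using d *(1) by auto
    qed
    then show ?thesis by auto
  qed
  moreover have "cells T' = cells T"
  proof -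
    have "(r, c) \<in> cells T' \<longleftrightarrow> (int r, int c) \<in> (residue n \<circ> corner1) ` F" for r c
    proof
      assume "(r, c) \<in> cells T'"
      then obtain x y d where "(x, y, d) \<in> F" "int r = x mod int n" "int c = y mod int n"
        unfolding cells_def T' by auto
      then show "(int r, int c) \<in> (residue n \<circ> corner1) ` F"
        by (intro image_eqI[of _ _ "(x, y, d)"]) (auto simp: residue_def corner_defs)
    next
      assume "(int r, int c) \<in> (residue n \<circ> corner1) ` F"
      then obtain x y d where "(x, y, d) \<in> F" "int r = x mod int n" "int c = y mod int n"
        by (auto simp: residue_def corner_defs)
      then have "(r, c, nat ((x + y + d) mod int n)) \<in> T'"
        unfolding T' using n by auto
      then show "(r, c) \<in> cells T'" unfolding cells_def by auto
    qed
    moreover have "(r, c) \<in> cells T \<longleftrightarrow> (int r, int c) \<in> S" for r c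
    proof -
      have "(int r, int c) \<in> S \<Longrightarrow> (r, c, nat ((int r + int c) mod int n)) \<in> T"
        unfolding T using n by auto
      then have "(\<exists>s. (r, c, s) \<in> T) \<longleftrightarrow> (int r, int c) \<in> S"
        using T by blast
      then show ?thesis by (simp add: cells_def)
    qed
    ultimately show ?thesis using img(1) by auto
  qed
  moreover have "row_symbols T' r = row_symbols T r" if "r < n" for r
  proof -
    have "s \<in> row_symbols T' r \<longleftrightarrow> s \<in> row_symbols T r" for s
    proof
      assume "s \<in> row_symbols T' r"
      then obtain x y d where *: "(x, y, d) \<in> F" "int r = x mod int n" "int s = (x + y + d) mod int n"
        unfolding row_symbols_def T' by auto
      then have "residue n (corner2 (x, y, d)) \<in> S" using img(2) by auto
      then have "(int r, (y + d) mod int n) \<in> S"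
        using * by (simp add: residue_def corner_defs)
      moreover have "int s = (int r + (y + d) mod int n) mod int n"
        using * by (simp add: mod_add_eq add.assoc)
      ultimately have "(r, nat ((y + d) mod int n), s) \<in> T"
        unfolding T using n by auto
      then show "s \<in> row_symbols T r" unfolding row_symbols_def by auto
    next
      assume "s \<in> row_symbols T r"
      then obtain c where *: "(int r, int c) \<in> S" "int s = (int r + int c) mod int n"
        unfolding row_symbols_def T by auto
      then obtain x y d where F: "(x, y, d) \<in> F" "int r = x mod int n" "int c = (y + d) mod int n"
        unfolding img(2)[symmetric] by (auto simp: residue_def corner_defs)
      then have "int s = (x + y + d) mod int n"
        using *(2) by (simp add: mod_add_eq add.assoc)
      then have "(r, nat (y mod int n), s) \<in> T'"
        unfolding T' using F n by auto
      then show "s \<in> row_symbols T' r" unfolding row_symbols_def by auto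
    qed
    then show ?thesis by blast
  qed
  moreover have "col_symbols T' c = col_symbols T c" if "c < n" for c
  proof -
    have "s \<in> col_symbols T' c \<longleftrightarrow> s \<in> col_symbols T c" for s
    proof
      assume "s \<in> col_symbols T' c"
      then obtain x y d where *: "(x, y, d) \<in> F" "int c = y mod int n" "int s = (x + y + d) mod int n"
        unfolding col_symbols_def T' by auto
      then have "residue n (corner3 (x, y, d)) \<in> S" using img(3) by auto
      then have "((x + d) mod int n, int c) \<in> S"
        using * by (simp add: residue_def corner_defs)
      moreover have "int s = ((x + d) mod int n + int c) mod int n"
        using * by (simp add: mod_add_eq algebra_simps)
      ultimately have "(nat ((x + d) mod int n), c, s) \<in> T"
        unfolding T using n by auto
      then show "s \<in> col_symbols T c" unfolding col_symbols_def by auto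
    next
      assume "s \<in> col_symbols T c"
      then obtain r where *: "(int r, int c) \<in> S" "int s = (int r + int c) mod int n"
        unfolding col_symbols_def T by auto
      then obtain x y d where F: "(x, y, d) \<in> F" "int r = (x + d) mod int n" "int c = y mod int n"
        unfolding img(3)[symmetric] by (auto simp: residue_def corner_defs)
      then have "int s = (x + y + d) mod int n"
        using *(2) by (simp add: mod_add_eq algebra_simps)
      then have "(nat (x mod int n), c, s) \<in> T'"
        unfolding T' using F n by auto
      then show "s \<in> col_symbols T' c" unfolding col_symbols_def by auto
    qed
    then show ?thesis by blast
  qed
  ultimately show ?thesis
    unfolding latin_trade_in_def T_def by blast
qed

lemma residue_eq: "(x, y) \<in> {0..<int n} \<times> {0..<int n} \<Longrightarrow> residue n (x, y) = (x, y)"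
  by (auto simp: residue_def)

text \<open>The box and the two added triangles make up a triangle of leg \<open>n\<close>, whose
  three corners coincide modulo \<open>n\<close>. The added triangles supply at each corner of the
  box the kinds that \<open>F\<close> lacks.\<close>

lemma triangle_trade:
  assumes m: "0 < m" "int n = 2 * m + 1" and F: "tiled F V m (m + 1)"
  defines "G \<equiv> F \<union> {(m, 0, m + 1), (0, m + 1, m)}"
    and "S \<equiv> V \<union> {(0, 0), (m, 0), (0, m + 1), (m, m + 1)}"
  shows "bij_betw (residue n \<circ> corner1) G S" "bij_betw (residue n \<circ> corner2) G S"
    "bij_betw (residue n \<circ> corner3) G S" "\<forall>(x, y, d)\<in>G. \<not> int n dvd d"
    "S \<subseteq> {0..<int n} \<times> {0..<int n}"
proof -
  let ?H = "{(m, 0, m + 1), (0, m + 1, m)} :: (int \<times> int \<times> int) set"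
  have V: "V \<subseteq> {0..m} \<times> {0..m + 1} - {(0, 0), (m, 0), (0, m + 1), (m, m + 1)}"
    and d: "\<forall>(x, y, d)\<in>F. d \<noteq> 0"
    and bij: "bij_betw corner1 F (V \<union> {(0, 0), (m, m + 1)})"
      "bij_betw corner2 F (V \<union> {(m, 0), (0, m + 1)})" "bij_betw corner3 F (V \<union> {(m, 0), (0, m + 1)})"
    using F unfolding tiled_def by blast+
  have box: "{0..m} \<times> {0..m + 1} \<subseteq> {0..<int n} \<times> {0..<int n}"
    using m by auto
  show S: "S \<subseteq> {0..<int n} \<times> {0..<int n}"
    unfolding S_def using V m by auto
  have red: "bij_betw (residue n \<circ> f) F B" if "bij_betw f F B" "B \<subseteq> {0..m} \<times> {0..m + 1}" for f B
  proof -
    have "residue n (f t) = f t" if "t \<in> F" for t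
    proof -
      have "f t \<in> {0..<int n} \<times> {0..<int n}"
        using that \<open>bij_betw f F B\<close> \<open>B \<subseteq> {0..m} \<times> {0..m + 1}\<close> box by (auto simp: bij_betw_def)
      then show ?thesis using residue_eq[of "fst (f t)" "snd (f t)"] by simp
    qed
    then show ?thesis
      using that(1) by (simp add: bij_betw_cong[of F "residue n \<circ> f" f])
  qed
  have "V \<subseteq> {0..m} \<times> {0..m + 1}" using V by blast
  then have red_F: "bij_betw (residue n \<circ> corner1) F (V \<union> {(0, 0), (m, m + 1)})"
    "bij_betw (residue n \<circ> corner2) F (V \<union> {(m, 0), (0, m + 1)})"
    "bij_betw (residue n \<circ> corner3) F (V \<union> {(m, 0), (0, m + 1)})"
    using m by (intro red bij; simp)+
  have red_H: "bij_betw (residue n \<circ> corner1) ?H {(m, 0), (0, m + 1)}"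
    "bij_betw (residue n \<circ> corner2) ?H {(m, m + 1), (0, 0)}"
    "bij_betw (residue n \<circ> corner3) ?H {(0, 0), (m, m + 1)}"
    using m by (auto simp: bij_betw_def corner_defs residue_def)
  have disj: "(V \<union> {(0, 0), (m, m + 1)}) \<inter> {(m, 0), (0, m + 1)} = {}"
    "(V \<union> {(m, 0), (0, m + 1)}) \<inter> {(m, m + 1), (0, 0)} = {}"
    "(V \<union> {(m, 0), (0, m + 1)}) \<inter> {(0, 0), (m, m + 1)} = {}"
    using V m by auto
  have "bij_betw (residue n \<circ> corner1) G ((V \<union> {(0, 0), (m, m + 1)}) \<union> {(m, 0), (0, m + 1)})"
    "bij_betw (residue n \<circ> corner2) G ((V \<union> {(m, 0), (0, m + 1)}) \<union> {(m, m + 1), (0, 0)})"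
    "bij_betw (residue n \<circ> corner3) G ((V \<union> {(m, 0), (0, m + 1)}) \<union> {(0, 0), (m, m + 1)})"
    unfolding G_def
    by (fact bij_betw_combine[OF red_F(1) red_H(1) disj(1)] bij_betw_combine[OF red_F(2) red_H(2) disj(2)]
        bij_betw_combine[OF red_F(3) red_H(3) disj(3)])+
  moreover have "(V \<union> {(0, 0), (m, m + 1)}) \<union> {(m, 0), (0, m + 1)} = S"
    "(V \<union> {(m, 0), (0, m + 1)}) \<union> {(m, m + 1), (0, 0)} = S"
    "(V \<union> {(m, 0), (0, m + 1)}) \<union> {(0, 0), (m, m + 1)} = S"
    unfolding S_def by auto
  ultimately show "bij_betw (residue n \<circ> corner1) G S" "bij_betw (residue n \<circ> corner2) G S"
    "bij_betw (residue n \<circ> corner3) G S"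
    by simp_all
  have "\<not> int n dvd d" if "(x, y, d) \<in> G" for x y d
  proof -
    \<comment> \<open>For a triangle of \<open>F\<close>, both \<open>x\<close> and
      \<open>x + d\<close> lie in \<open>{0..m}\<close>, so no leg is long enough to vanish modulo
      \<open>n\<close>.\<close>
    have "d \<noteq> 0 \<and> \<bar>d\<bar> < int n"
    proof (cases "(x, y, d) \<in> F")
      case True
      then have "corner1 (x, y, d) \<in> V \<union> {(0, 0), (m, m + 1)}" "corner3 (x, y, d) \<in> V \<union> {(m, 0), (0, m + 1)}"
        using bij by (auto simp: bij_betw_def)
      then have "x \<in> {0..m}" "x + d \<in> {0..m}"
        using V m by (auto simp: corner_defs)
      then show ?thesis using True d m by auto
    next
      case False
      then show ?thesis using that m by (auto simp: G_def)
    qed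
    then show ?thesis using zdvd_not_zless[of "\<bar>d\<bar>" "int n"] by auto
  qed
  then show "\<forall>(x, y, d)\<in>G. \<not> int n dvd d" by auto
qed

text \<open>Multiplication by a unit and translation are bijections of the torus that take triangles
  to triangles.\<close>

lemma affine_trade:
  assumes n: "0 < n" and S: "S \<subseteq> {0..<int n} \<times> {0..<int n}" "S \<noteq> {}"
    and bij: "bij_betw (residue n \<circ> corner1) F S" "bij_betw (residue n \<circ> corner2) F S"
      "bij_betw (residue n \<circ> corner3) F S"
    and d: "\<forall>(x, y, d)\<in>F. \<not> int n dvd d" and u: "coprime u (int n)"
  shows "latin_trade_in n (add_table n)
    ((\<lambda>(x, y). sum_entry n (residue n (u * x, u * y + b))) ` S)"
proof -
  let ?p = "\<lambda>(x, y). residue n (u * x, u * y + b)"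
  let ?q = "\<lambda>(x, y, d). (u * x, u * y + b, u * d)"
  have cancel: "x = x'" if "(u * x) mod int n = (u * x') mod int n"
    "x \<in> {0..<int n}" "x' \<in> {0..<int n}" for x x'
  proof -
    have "[u * x = u * x'] (mod int n)" using that(1) by (simp add: cong_def)
    then have "[x = x'] (mod int n)" using u cong_mult_lcancel by blast
    then show ?thesis using that(2,3) by (simp add: cong_def)
  qed
  have "inj_on ?p S"
  proof (rule inj_onI)
    fix s s' assume s: "s \<in> S" "s' \<in> S" "?p s = ?p s'"
    obtain x y x' y' where xy: "s = (x, y)" "s' = (x', y')" by (cases s, cases s')
    with s have "(u * x) mod int n = (u * x') mod int n" "(u * y + b) mod int n = (u * y' + b) mod int n"
      by (auto simp: residue_def)
    moreover from this(2) have "(u * y) mod int n = (u * y') mod int n"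
      by (metis add_diff_cancel_right' mod_diff_left_eq)
    moreover have "x \<in> {0..<int n}" "x' \<in> {0..<int n}" "y \<in> {0..<int n}" "y' \<in> {0..<int n}"
      using s(1,2) xy S(1) by blast+
    ultimately show "s = s'"
      unfolding xy using cancel by blast
  qed
  then have p: "bij_betw ?p S (?p ` S)" by (simp add: bij_betw_def)
  have transfer: "bij_betw (residue n \<circ> f) (?q ` F) (?p ` S)"
    if "bij_betw (residue n \<circ> f) F S" and "\<And>t. f (?q t) = (\<lambda>(x, y). (u * x, u * y + b)) (f t)" for f
  proof -
    have "?p (residue n (f t)) = residue n (f (?q t))" for t
    proof -
      have "(u * (y mod int n) + c) mod int n = (u * y + c) mod int n" for y c
        by (metis mod_add_left_eq mod_mult_right_eq)
      from this[of _ 0] this[of _ b] show ?thesis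
        unfolding that(2) by (cases "f t") (simp add: residue_def)
    qed
    then have eq: "residue n \<circ> f \<circ> ?q = ?p \<circ> (residue n \<circ> f)"
      by (simp add: fun_eq_iff)
    have *: "bij_betw (residue n \<circ> f \<circ> ?q) F (?p ` S)"
      unfolding eq by (rule bij_betw_trans[OF that(1) p])
    then have "inj_on (residue n \<circ> f) (?q ` F)"
      by (simp add: bij_betw_def inj_on_imageI)
    moreover have "(residue n \<circ> f) ` ?q ` F = ?p ` S"
      using * by (simp add: bij_betw_def image_comp)
    ultimately show ?thesis by (simp add: bij_betw_def)
  qed
  have "latin_trade_in n (add_table n) (sum_entry n ` ?p ` S)"
  proof (rule latin_trade_of_tiles[OF n])
    show "?p ` S \<subseteq> {0..<int n} \<times> {0..<int n}" "?p ` S \<noteq> {}"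
      using n S(2) by (auto simp: residue_def)
    show "bij_betw (residue n \<circ> corner1) (?q ` F) (?p ` S)"
      by (rule transfer[OF bij(1)]) (auto simp: corner_defs)
    show "bij_betw (residue n \<circ> corner2) (?q ` F) (?p ` S)"
      by (rule transfer[OF bij(2)]) (auto simp: corner_defs algebra_simps)
    show "bij_betw (residue n \<circ> corner3) (?q ` F) (?p ` S)"
      by (rule transfer[OF bij(3)]) (auto simp: corner_defs algebra_simps)
    show "\<forall>(x, y, d)\<in>?q ` F. \<not> int n dvd d"
      using d u by (auto simp: coprime_dvd_mult_right_iff coprime_commute)
  qed
  moreover have "sum_entry n ` ?p ` S = (\<lambda>(x, y). sum_entry n (residue n (u * x, u * y + b))) ` S"
    by (auto simp: image_comp intro!: image_cong)
  ultimately show ?thesis by simp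
qed

section \<open>Avoiding \<open>Q\<close> and the final count\<close>

text \<open>The translated entry is on the diagonal \<open>y - x + k + 1 + X\<close>. This number
  lies between \<open>k + 1\<close> and \<open>n - 1\<close>, the upper bound being
  \<open>fits\<close>, so it does not wrap around.\<close>

lemma sum_entry_notin_Q:
  assumes n: "0 < n" and "0 \<le> x" "x \<le> X" "0 \<le> y" "y \<le> Y" and fits: "X + Y + int k + 2 \<le> int n"
  shows "sum_entry n (residue n (x, y + (int k + 1 + X))) \<notin> Q n k"
proof
  assume "sum_entry n (residue n (x, y + (int k + 1 + X))) \<in> Q n k"
  then obtain i r where i: "i \<le> k" "r < n" "nat (x mod int n) = r"
      "nat ((y + (int k + 1 + X)) mod int n) = (r + i) mod n"
    unfolding Q_def diagonal_def sum_entry_def residue_def by auto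
  have "int r = x mod int n" using i(3) n by auto
  moreover have "int ((r + i) mod n) = (y + (int k + 1 + X)) mod int n"
    using n by (simp flip: i(4))
  ultimately have "(x + int i) mod int n = (y + (int k + 1 + X)) mod int n"
    by (simp add: of_nat_mod mod_simps)
  then have "int i mod int n = (y + (int k + 1 + X) - x) mod int n"
    by (metis add_diff_cancel_left' mod_diff_left_eq)
  then show False using i(1) assms by simp
qed

text \<open>The count covers the points \<open>W\<close> added by the halvings and the four corners
  of the outer box; all other points avoid \<open>Q\<close>.\<close>

lemma odd_trade:
  assumes n: "odd n" "1 < n" and t: "32 \<le> t" "int n \<le> 2 ^ i * t" and fits: "t + int k + 2 \<le> int n"
  shows "\<exists>T. latin_trade_in n (add_table n) T \<and> card (T \<inter> Q n k) \<le> odd_cost i + 4"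
proof -
  obtain m where m: "int n = 2 * m + 1" using n(1) by (metis even_of_nat oddE)
  then have m0: "0 < m" using n(2) by linarith
  have "reduces t (odd_cost i) (2 ^ 0 * ((int n - 1) div 2)) (2 ^ 0 * ((int n + 1) div 2))"
    using n(1) t fits
    by (intro conjunct1[OF reduces_near_rhombus[OF t(1)], rule_format]) (auto intro: order_trans)
  then have "reduces t (odd_cost i) m (m + 1)"
    using m by (simp add: add.commute)
  then obtain j X Y where XY: "0 < X" "0 < Y" "X + Y \<le> t" "X < Y \<and> Y \<le> 3 * X \<or> Y < X \<and> X \<le> 3 * Y"
    and ext: "extends (odd_cost i) m (m + 1) (2 ^ j * X) (2 ^ j * Y)"
    unfolding reduces_def by blast
  obtain F0 V0 where F0: "tiled F0 V0 X Y" "clear V0 X Y"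
    using XY tiled_clear_exists[of X Y] tiled_clear_exists[of Y X] tiled_swap clear_swap by metis
  define V where "V = (\<lambda>(x, y). (2 ^ j * x, 2 ^ j * y)) ` V0"
  obtain F W where F: "tiled F (V \<union> W) m (m + 1)" and W: "finite W" "card W \<le> odd_cost i"
    using ext tiled_scale[OF F0(1), of "2 ^ j"] clear_scale[OF F0(2), of "2 ^ j"]
    unfolding extends_def V_def by fastforce
  let ?C = "{(0, 0), (m, 0), (0, m + 1), (m, m + 1)}"
  have "coprime (2 ^ j) (int n)" using n(1) by simp
  \<comment> \<open>Multiplication by \<open>u\<close> undoes the factor \<open>2 ^ j\<close> modulo
    \<open>n\<close> and returns the points of \<open>V\<close> to the small box of sides
    \<open>X\<close> and \<open>Y\<close>.\<close>
  then obtain u where u: "[2 ^ j * u = 1] (mod int n)"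
    using cong_solve_coprime_int by blast
  then have cop: "coprime u (int n)"
    by (metis cong_imp_coprime coprime_1_left coprime_mult_left_iff cong_sym)
  let ?g = "\<lambda>(x, y). sum_entry n (residue n (u * x, u * y + (int k + 1 + X)))"
  let ?T = "?g ` (V \<union> W \<union> ?C)"
  have "latin_trade_in n (add_table n) ?T"
    using affine_trade[OF _ _ _ triangle_trade(1-4)[OF m0 m F] cop] triangle_trade(5)[OF m0 m F] n by auto
  moreover have "card (?T \<inter> Q n k) \<le> odd_cost i + 4"
  proof -
    have "?g p \<notin> Q n k" if p: "p \<in> V" for p
    proof -
      obtain x y where xy: "(x, y) \<in> V0" "p = (2 ^ j * x, 2 ^ j * y)"
        using p unfolding V_def by auto
      then have "0 \<le> x" "x \<le> X" "0 \<le> y" "y \<le> Y"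
        using F0(1) unfolding tiled_def by auto
      then have "sum_entry n (residue n (x, y + (int k + 1 + X))) \<notin> Q n k"
        using n(2) fits XY(3) by (intro sum_entry_notin_Q[of _ _ _ _ Y]) auto
      moreover have "(u * (2 ^ j * z) + b) mod int n = (z + b) mod int n" for z b
      proof -
        have "[2 ^ j * u * z + b = 1 * z + b] (mod int n)"
          using u by (intro cong_add cong_mult) auto
        then show ?thesis by (simp add: cong_def algebra_simps)
      qed
      from this[of x 0] this[of y] have "residue n (u * (2 ^ j * x), u * (2 ^ j * y) + (int k + 1 + X)) =
          residue n (x, y + (int k + 1 + X))"
        by (simp add: residue_def)
      ultimately show ?thesis using xy(2) by simp
    qed
    then have "?T \<inter> Q n k \<subseteq> ?g ` (W \<union> ?C)" by auto
    then have "card (?T \<inter> Q n k) \<le> card (?g ` (W \<union> ?C))"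
      using W(1) by (intro card_mono) auto
    also have "\<dots> \<le> card (W \<union> ?C)"
      using W(1) by (intro card_image_le) auto
    also have "\<dots> \<le> card W + card ?C" by (rule card_Un_le)
    also have "card ?C \<le> 4"
      using card_length[of "[(0, 0), (m, 0), (0, m + 1), (m, m + 1)]"] by simp
    finally show ?thesis using W(2) by simp
  qed
  ultimately show ?thesis by blast
qed

text \<open>Since \<open>2 * h\<close> is 0 modulo \<open>n\<close>, the four cells form a 2 by 2
  subsquare, whose two symbols are exchanged.\<close>

lemma even_trade:
  assumes "even n" "0 < n"
  shows "\<exists>T. latin_trade_in n (add_table n) T \<and> card T \<le> 4"
proof -
  obtain h where h: "n = 2 * h" using assms(1) by blast
  let ?h = "int h" and ?F = "{(0, 0, int h), (0, int h, int h), (int h, 0, int h), (int h, int h, int h)}"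
  let ?S = "{(0, 0), (0, int h), (int h, 0), (int h, int h)}"
  have "latin_trade_in n (add_table n) (sum_entry n ` ?S)"
    using h assms(2)
    by (intro latin_trade_of_tiles[where F = ?F])
      (auto simp: bij_betw_def corner_defs residue_def dest: zdvd_imp_le)
  moreover have "card (sum_entry n ` ?S) \<le> 4"
    using card_length[of "map (sum_entry n) [(0, 0), (0, int h), (int h, 0), (int h, int h)]"] by simp
  ultimately show ?thesis by blast
qed

theorem theorem17:
  fixes n :: nat and x :: real
  assumes "n > 0"
    and "x > 0"
    and "x \<le> real n"
    and "real n - 4 * real n / x \<ge> 30"
  shows "\<exists>T. latin_trade_in n (add_table n) T \<and>
    real (card (T \<inter> Q n (nat (int n - \<lceil>4 * real n / x\<rceil> - 30)))) \<le> 10 * log 4 (2 * x)"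
proof -
  \<comment> \<open>The constant 28 is chosen so that \<open>t + k + 2\<close> equals
    \<open>n\<close>, which just meets \<open>fits\<close> of \<open>odd_trade\<close>.\<close>
  define t where "t = \<lceil>4 * real n / x\<rceil> + 28"
  define k where "k = nat (int n - \<lceil>4 * real n / x\<rceil> - 30)"
  have "4 * real n / x < real n" using assms(4) by linarith
  then have x4: "4 < x" using assms(1,2) by (simp add: field_simps)
  have log4: "10 * log 4 (2 * x) = 5 + 5 * log 2 x"
  proof -
    have "log 4 (2 * x) = log 2 (2 * x) / log 2 4"
      by (rule log_base_change) auto
    also have "log 2 (4 :: real) = 2" using log_pow_cancel[of "2 :: real" 2] by simp
    finally show ?thesis using assms(2) by (simp add: log_mult)
  qed
  have log2: "2 < log 2 x" using x4 by (simp add: less_log_iff)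
  show ?thesis
  proof (cases "even n")
    case True
    then obtain T where T: "latin_trade_in n (add_table n) T" "card T \<le> 4"
      using even_trade assms(1) by blast
    then have "finite T"
      unfolding latin_trade_in_def pls_def by (meson finite_SigmaI finite_lessThan finite_subset)
    then have "card (T \<inter> Q n k) \<le> 4"
      using T(2) by (meson card_mono inf_le1 le_trans)
    then have "real (card (T \<inter> Q n k)) \<le> 10 * log 4 (2 * x)"
      using log4 log2 by linarith
    then show ?thesis using T(1) unfolding k_def by blast
  next
    case False
    have "4 * real n / x \<ge> 4"
      using assms(2,3) by (simp add: field_simps)
    then have t32: "32 \<le> t" unfolding t_def by linarith
    have "\<lceil>4 * real n / x\<rceil> \<le> int n - 30"
      using assms(4) by (simp add: ceiling_le_iff)
    then have fits: "t + int k + 2 \<le> int n" unfolding t_def k_def by linarith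
    have ex: "\<exists>i. int n \<le> 2 ^ i * t"
    proof
      have "int n \<le> 2 ^ n" by (metis less_exp of_nat_less_iff less_le of_nat_numeral of_nat_power)
      also have "\<dots> \<le> 2 ^ n * t" using t32 by simp
      finally show "int n \<le> 2 ^ n * t" .
    qed
    define i where "i = (LEAST i. int n \<le> 2 ^ i * t)"
    have i: "int n \<le> 2 ^ i * t" using ex unfolding i_def by (rule LeastI_ex)
    have "1 < n" using fits t32 by linarith
    then obtain T where T: "latin_trade_in n (add_table n) T" "card (T \<inter> Q n k) \<le> odd_cost i + 4"
      using odd_trade[OF False _ t32 i fits] by blast
    have "real (odd_cost i + 4) \<le> 5 + 5 * log 2 x"
    proof (cases i)
      case 0
      then show ?thesis using log2 by (simp add: odd_cost_def)
    next
      case (Suc l)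
      \<comment> \<open>Minimality of \<open>i\<close> gives \<open>2 ^ (i + 1) < x\<close>, hence
        \<open>i + 1 < log 2 x\<close>; and \<open>odd_cost i + 4\<close> is
        \<open>5 * (i + 1) + 3\<close>.\<close>
      have "\<not> int n \<le> 2 ^ l * t"
        using not_less_Least[of l] Suc unfolding i_def by (metis lessI)
      then have "real_of_int (2 ^ l * t) < real_of_int (int n)"
        by (simp only: of_int_less_iff not_le)
      then have "2 ^ l * real_of_int t < real n" by simp
      moreover have "4 * real n / x \<le> real_of_int t" unfolding t_def by linarith
      then have "2 ^ l * (4 * real n / x) \<le> 2 ^ l * real_of_int t"
        by (intro mult_left_mono) auto
      ultimately have "2 ^ l * (4 * real n / x) < real n" by linarith
      then have "2 ^ (l + 2) < x"
        using assms(1,2) by (simp add: field_simps power_add)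
      then have "real (l + 2) < log 2 x"
        using assms(2) by (simp add: less_log_iff powr_add powr_realpow)
      then show ?thesis using Suc by (simp add: odd_cost_def)
    qed
    then have "real (card (T \<inter> Q n k)) \<le> 10 * log 4 (2 * x)"
      using T(2) log4 by linarith
    then show ?thesis using T(1) unfolding k_def by blast
  qed
qed

end
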